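(* Let $t\geq 2$ be an integer. (1) If $m\geq 3$ is an integer, then for every integer $c$ with $mt\leq c\leq mt^2$ and $c\neq mt+1$, there exists a quantum Latin square of order $mt$ with cardinality $c$. (2) If $m=2$, then for every even integer $c$ with $2t\leq c\leq 2t^2$, there exists a quantum Latin square of order $2t$ with cardinality $c$.
   Context: A quantum Latin square of order $v$, QLS$(v)$, is a $v\times v$ array $\Phi=(|\Phi_{i,j}\rangle)$ whose entries are unit column vectors of $\mathbb{C}^v$ such that the entries of every row form an orthonormal basis of $\mathbb{C}^v$ and the entries of every column form an orthonormal basis of $\mathbb{C}^v$. Two unit vectors $|u\rangle,|w\rangle\in\mathbb{C}^v$ have the same global phase if $|u\rangle=e^{\mathrm{i}\theta}|w\rangle$ for some $\theta\in[0,2\pi)$; otherwise they are distinct (up to a global phase). The cardinality of a QLS$(v)$ is the number of its entries that are distinct up to a global phase, i.e. the number of classes of its $v^2$ entries under the relation "same global phase". *)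

theory Defs
  imports "Jordan_Normal_Form.Gram_Schmidt"
begin

text \<open>The space of column vectors of length \<open>v\<close> over the complex numbers is
  \<open>carrier_vec v :: complex vec set\<close>, the carrier of the vector space \<open>module_vec TYPE(complex) v\<close>.
  An orthonormal basis is a family, not a set, so that repeated entries of a row are excluded.\<close>

definition orthonormal_basis :: "nat \<Rightarrow> (nat \<Rightarrow> complex vec) \<Rightarrow> bool" where
  "orthonormal_basis v f \<longleftrightarrow>
     (\<forall>i<v. \<forall>j<v. f i \<bullet>c f j = (if i = j then 1 else 0)) \<and>
     vectorspace.basis class_ring (module_vec TYPE(complex) v) (f ` {..<v})"

text \<open>A \<open>v \<times> v\<close> array of vectors is a matrix with entries in \<open>complex vec\<close>; its indices
  run from \<open>0\<close> to \<open>v - 1\<close>. That the entries are unit vectors of length \<open>v\<close> is part of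
  \<open>orthonormal_basis\<close>.\<close>

definition quantum_latin_square :: "nat \<Rightarrow> complex vec mat \<Rightarrow> bool" where
  "quantum_latin_square v \<Phi> \<longleftrightarrow>
     \<Phi> \<in> carrier_mat v v \<and>
     (\<forall>i<v. orthonormal_basis v (\<lambda>j. \<Phi> $$ (i, j))) \<and>
     (\<forall>j<v. orthonormal_basis v (\<lambda>i. \<Phi> $$ (i, j)))"

definition same_global_phase :: "complex vec \<Rightarrow> complex vec \<Rightarrow> bool" where
  "same_global_phase u w \<longleftrightarrow> (\<exists>\<theta>\<in>{0..<2 * pi}. u = exp (\<i> * complex_of_real \<theta>) \<cdot>\<^sub>v w)"

definition qls_cardinality :: "complex vec mat \<Rightarrow> nat" where
  "qls_cardinality \<Phi> =
     card (elements_mat \<Phi> // {(u, w). u \<in> elements_mat \<Phi> \<and> w \<in> elements_mat \<Phi> \<and> same_global_phase u w})"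

lemma same_global_phase_iff_cmod:
  "same_global_phase u w \<longleftrightarrow> (\<exists>z. cmod z = 1 \<and> u = z \<cdot>\<^sub>v w)"
proof
  assume "same_global_phase u w"
  then show "\<exists>z. cmod z = 1 \<and> u = z \<cdot>\<^sub>v w"
    unfolding same_global_phase_def by (metis cis_conv_exp norm_cis)
next
  assume "\<exists>z. cmod z = 1 \<and> u = z \<cdot>\<^sub>v w"
  then obtain z where z: "cmod z = 1" "u = z \<cdot>\<^sub>v w" by blast
  obtain t where "0 \<le> t" "t < 2 * pi" "z = Complex (cos t) (sin t)"
    using complex_unimodular_polar[OF z(1)] by metis
  then have "t \<in> {0..<2 * pi}" "z = exp (\<i> * complex_of_real t)"
    by (auto simp: cis.code cis_conv_exp[symmetric])
  with z(2) show "same_global_phase u w"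
    unfolding same_global_phase_def by blast
qed

lemma equiv_same_global_phase:
  "equiv A {(u, w). u \<in> A \<and> w \<in> A \<and> same_global_phase u w}"
proof (rule equivI)
  show "refl_on A {(u, w). u \<in> A \<and> w \<in> A \<and> same_global_phase u w}"
    unfolding refl_on_def same_global_phase_iff_cmod
    by (auto intro!: exI[of _ 1])
  show "sym {(u, w). u \<in> A \<and> w \<in> A \<and> same_global_phase u w}"
  proof (rule symI, clarsimp simp: same_global_phase_iff_cmod)
    fix z :: complex and w :: "complex vec"
    assume z: "cmod z = 1"
    then have "z \<noteq> 0" by auto
    with z show "\<exists>y. cmod y = 1 \<and> w = y \<cdot>\<^sub>v (z \<cdot>\<^sub>v w)"
      by (intro exI[of _ "inverse z"])
        (auto simp: norm_inverse smult_smult_assoc)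
  qed
  have "\<exists>z. cmod z = 1 \<and> u = z \<cdot>\<^sub>v x"
    if "cmod p = 1" "u = p \<cdot>\<^sub>v w" "cmod q = 1" "w = q \<cdot>\<^sub>v x" for u w x :: "complex vec" and p q
    using that by (intro exI[of _ "p * q"]) (auto simp: smult_smult_assoc norm_mult)
  then show "trans {(u, w). u \<in> A \<and> w \<in> A \<and> same_global_phase u w}"
    unfolding trans_def same_global_phase_iff_cmod by blast
qed auto

end

theory Submission
  imports Defs
begin

text \<open>Split \<open>\<complex>\<^sup>m\<^sup>t\<close> into \<open>t\<close> orthogonal coordinate subspaces of dimension \<open>m\<close>. Block \<open>(i, j)\<close>
  of the array is a cyclic Latin square of order \<open>m\<close> written in some orthonormal basis of
  subspace \<open>(i + j) mod t\<close>; the basis may depend on the block. So each subspace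
  carries \<open>t\<close> bases, indexed by \<open>i\<close>. The one for \<open>i = 0\<close> is the standard basis; each other one
  is obtained from it by rotating \<open>d\<close> of its vectors into new directions, which is possible
  for every \<open>d \<le> m\<close> except \<open>d = 1\<close>. The cardinality is \<open>m t\<close> plus the sum of the \<open>t (t - 1)\<close>
  numbers \<open>d\<close>, and that sum takes every value up to \<open>m t (t - 1)\<close> except \<open>1\<close>, or, for \<open>m = 2\<close>,
  every even value.\<close>

section \<open>Residues, quotient sets and orthonormal families\<close>

lemma add_mod_left_inject:
  fixes c x y n :: nat
  assumes "x < n" "y < n" "(c + x) mod n = (c + y) mod n"
  shows "x = y"
proof -
  have "x = y" if "x \<le> y" "y < n" "(c + y) mod n = (c + x) mod n" for x y
  proof -
    have "n dvd (c + y) - (c + x)"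
      using that by (subst mod_eq_dvd_iff_nat[symmetric]) auto
    then show ?thesis
      using that dvd_imp_le[of n "y - x"] by (cases "x < y") auto
  qed
  then show ?thesis
    using assms by (cases "x \<le> y") (metis, metis nat_le_linear)
qed

text \<open>\<open>f\<close> maps \<open>I\<close> to a system of representatives, so sending
  \<open>i\<close> to the class of \<open>f i\<close> is a bijection.\<close>

lemma card_quotient_eq:
  assumes "equiv A R" "f ` I \<subseteq> A"
    and onto: "\<And>x. x \<in> A \<Longrightarrow> \<exists>i\<in>I. (f i, x) \<in> R"
    and inj: "\<And>i j. i \<in> I \<Longrightarrow> j \<in> I \<Longrightarrow> (f i, f j) \<in> R \<Longrightarrow> i = j"
  shows "card (A // R) = card I"
proof -
  have "bij_betw (\<lambda>i. R `` {f i}) I (A // R)"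
    unfolding bij_betw_def
  proof
    show "inj_on (\<lambda>i. R `` {f i}) I"
      using assms(2) eq_equiv_class_iff[OF assms(1)] by (intro inj_onI inj) blast+
    show "(\<lambda>i. R `` {f i}) ` I = A // R"
    proof
      show "(\<lambda>i. R `` {f i}) ` I \<subseteq> A // R"
        using assms(2) by (auto intro: quotientI)
      show "A // R \<subseteq> (\<lambda>i. R `` {f i}) ` I"
        using onto equiv_class_eq[OF assms(1)] by (fastforce elim!: quotientE)
    qed
  qed
  then show ?thesis by (simp add: bij_betw_same_card)
qed

lemma sum_cscalar_prod:
  fixes v w :: "complex vec"
  assumes "dim_vec v = n" "dim_vec w = n"
  shows "v \<bullet>c w = (\<Sum>i<n. v $ i * cnj (w $ i))"
  using assms by (auto simp: scalar_prod_def lessThan_atLeast0)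

text \<open>Orthonormality says that the matrix with rows \<open>f i\<close> times its conjugate
  transpose is the identity. Hence its determinant is nonzero and the \<open>v\<close> vectors,
  pairwise different, are independent.\<close>

lemma orthonormal_basisI:
  assumes car: "\<And>i. i < v \<Longrightarrow> f i \<in> carrier_vec v"
    and on: "\<And>i j. i < v \<Longrightarrow> j < v \<Longrightarrow> f i \<bullet>c f j = (if i = j then 1 else 0)"
  shows "orthonormal_basis v f"
proof -
  interpret vec_space "TYPE(complex)" v .
  have inj: "inj_on f {..<v}"
  proof (rule inj_onI)
    fix i j assume "i \<in> {..<v}" "j \<in> {..<v}" "f i = f j"
    then show "i = j" using on[of i j] on[of i i] by (auto split: if_splits)
  qed
  define A where "A = mat v v (\<lambda>(i, j). f i $ j)"
  define B where "B = mat v v (\<lambda>(i, j). cnj (f j $ i))"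
  have "A * B = 1\<^sub>m v"
  proof (rule eq_matI)
    fix i j assume ij: "i < dim_row (1\<^sub>m v :: complex mat)" "j < dim_col (1\<^sub>m v :: complex mat)"
    then have "(A * B) $$ (i, j) = (\<Sum>k<v. f i $ k * cnj (f j $ k))"
      by (auto simp: A_def B_def scalar_prod_def lessThan_atLeast0)
    also have "\<dots> = f i \<bullet>c f j"
      using car[of i] car[of j] ij by (subst sum_cscalar_prod) auto
    finally show "(A * B) $$ (i, j) = 1\<^sub>m v $$ (i, j)"
      using ij on by auto
  qed (auto simp: A_def B_def)
  then have "det A * det B = 1"
    using det_mult[of A v B] by (simp add: A_def B_def)
  then have "det A \<noteq> 0" by auto
  moreover have "rows A = map f [0..<v]"
    by (auto simp: A_def rows_def carrier_vecD[OF car] intro!: eq_vecI)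
  then have "set (rows A) = f ` {..<v}"
    by (auto simp: atLeast0LessThan)
  ultimately have "lin_indpt (f ` {..<v})"
    using det_not_0_imp_lin_indpt_rows[of A] by (simp add: A_def)
  then have "basis (f ` {..<v})"
    using car inj by (intro dim_li_is_basis) (auto simp: dim_is_n card_image)
  then show ?thesis
    using on unfolding orthonormal_basis_def by auto
qed

section \<open>Fourier bases twisted by a diagonal unitary\<close>

lemma cis_unity_root_inject:
  assumes "a < n" "b < n" "cis (2 * pi * real a / real n) = cis (2 * pi * real b / real n)"
  shows "a = b"
  using bij_betw_roots_unity[of n] assms by (auto simp: bij_betw_def inj_on_def)

text \<open>For fixed \<open>p < t\<close> the first \<open>d\<close> vectors are the Fourier basis of the first \<open>d\<close>
  coordinates, multiplied by the diagonal unitary with entries \<open>\<zeta>\<^sup>p\<^sup>j\<close>, \<open>\<zeta> = exp (2 \<pi> \<i> / (d t))\<close>.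
  The \<open>a\<close>-th vector is then determined by its entry \<open>\<zeta> ^ (a t + p) / \<surd>d\<close> at \<open>j = 1\<close>, so
  that the bases for different \<open>p\<close> have no direction in common as soon as \<open>d \<ge> 2\<close>.\<close>

definition twisted_fourier :: "nat \<Rightarrow> nat \<Rightarrow> nat \<Rightarrow> nat \<Rightarrow> nat \<Rightarrow> complex" where
  "twisted_fourier t d p a j =
     (if a < d
      then if j < d then cis (2 * pi * real (a * t + p) * real j / real (d * t)) / sqrt (real d) else 0
      else if j = a then 1 else 0)"

text \<open>For \<open>a, b < d\<close> the twist by \<open>p\<close> cancels against its conjugate.
  What remains is a geometric sum over a \<open>d\<close>-th root of unity \<open>x\<close>, which
  vanishes unless \<open>x = 1\<close>.\<close>

lemma twisted_fourier_orthonormal: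
  assumes "0 < t" "d \<le> m" "a < m" "b < m"
  shows "(\<Sum>j<m. twisted_fourier t d p a j * cnj (twisted_fourier t d p b j)) = (if a = b then 1 else 0)"
proof (cases "a < d \<and> b < d")
  case True
  then have d: "d > 0" by auto
  define x where "x = cis (2 * pi * real a / real d) / cis (2 * pi * real b / real d)"
  have "x ^ d = 1"
    using d by (simp add: x_def power_divide DeMoivre)
  have x1: "x = 1 \<longleftrightarrow> a = b"
    using True cis_unity_root_inject[of a d b] by (auto simp: x_def)
  have summand: "twisted_fourier t d p a j * cnj (twisted_fourier t d p b j) = x ^ j / d" if "j < d" for j
  proof -
    have "twisted_fourier t d p a j * cnj (twisted_fourier t d p b j)
        = cis (2 * pi * real (a * t + p) * real j / real (d * t)
               - 2 * pi * real (b * t + p) * real j / real (d * t)) / d"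
      using True that d by (simp add: twisted_fourier_def cis_cnj cis_mult flip: of_real_mult)
    also have "2 * pi * real (a * t + p) * real j / real (d * t)
               - 2 * pi * real (b * t + p) * real j / real (d * t)
        = real j * (2 * pi * real a / real d - 2 * pi * real b / real d)"
      using d assms(1) by (simp add: field_simps)
    also have "cis \<dots> = x ^ j"
      by (simp add: x_def cis_divide DeMoivre)
    finally show ?thesis .
  qed
  have neutral: "twisted_fourier t d p a j = 0" if "\<not> j < d" for j
    using that True by (simp add: twisted_fourier_def)
  have "(\<Sum>j<m. twisted_fourier t d p a j * cnj (twisted_fourier t d p b j)) = (\<Sum>j<d. x ^ j / d)"
    using True assms(2) by (intro sum.mono_neutral_cong_right) (auto simp: summand neutral)
  also have "\<dots> = (if a = b then 1 else 0)"
    using x1 \<open>x ^ d = 1\<close> d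
    by (cases "x = 1") (simp_all add: sum_divide_distrib[symmetric] geometric_sum)
  finally show ?thesis .
next
  case False
  have *: "(\<Sum>j<m. if j = a then f j else 0) = f a" "(\<Sum>j<m. if j = b then f j else 0) = f b"
    for f :: "nat \<Rightarrow> complex"
    using assms by auto
  consider "a \<ge> d" | "b \<ge> d" using False by linarith
  then show ?thesis
  proof cases
    case 1
    then have "(\<Sum>j<m. twisted_fourier t d p a j * cnj (twisted_fourier t d p b j))
        = (\<Sum>j<m. if j = a then cnj (twisted_fourier t d p b j) else 0)"
      by (intro sum.cong) (auto simp: twisted_fourier_def)
    also have "\<dots> = (if a = b then 1 else 0)"
      unfolding * using 1 by (auto simp: twisted_fourier_def)
    finally show ?thesis .
  next
    case 2
    then have "(\<Sum>j<m. twisted_fourier t d p a j * cnj (twisted_fourier t d p b j))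
        = (\<Sum>j<m. if j = b then twisted_fourier t d p a j else 0)"
      by (intro sum.cong) (auto simp: twisted_fourier_def)
    also have "\<dots> = (if a = b then 1 else 0)"
      unfolding * using 2 by (auto simp: twisted_fourier_def)
    finally show ?thesis .
  qed
qed

lemma twisted_fourier_nonzero:
  assumes "a < d" "j < d"
  shows "twisted_fourier t d p a j \<noteq> 0"
  using assms by (simp add: twisted_fourier_def)

text \<open>The entries at \<open>0\<close> force \<open>d = d'\<close>, by taking absolute values,
  and then \<open>z = 1\<close>. The entries at \<open>1\<close>, available since \<open>d\<close>
  is at least \<open>2\<close>, are \<open>d t\<close>-th roots of unity with exponent
  \<open>a * t + p < d * t\<close>; division by \<open>t\<close> recovers \<open>a\<close> and
  \<open>p\<close>.\<close>

lemma twisted_fourier_inject: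
  assumes "p < t" "p' < t" "a < d" "a' < d'" "2 \<le> d" "d \<le> m" "2 \<le> d'" "d' \<le> m" "cmod z = 1"
    and eq: "\<And>j. j < m \<Longrightarrow> twisted_fourier t d p a j = z * twisted_fourier t d' p' a' j"
  shows "p = p' \<and> a = a'"
proof -
  have d0: "1 / sqrt (real d) = z / sqrt (real d')"
    using eq[of 0] assms by (simp add: twisted_fourier_def)
  then have "cmod (1 / sqrt (real d)) = cmod (z / sqrt (real d'))" by simp
  then have dd: "d = d'"
    using assms by (simp add: norm_divide)
  with d0 have z: "z = 1"
    using assms by (simp add: field_simps)
  have less: "a * t + p < d * t" if "a < d" "p < t" for a p
  proof -
    have "a * t + p < Suc a * t" using that by simp
    also have "\<dots> \<le> d * t" using that by (intro mult_le_mono) auto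
    finally show ?thesis .
  qed
  have "a * t + p = a' * t + p'"
    using eq[of 1] assms dd z
    by (intro cis_unity_root_inject[of _ "d * t"] less) (simp_all add: twisted_fourier_def)
  then have "(a * t + p) div t = (a' * t + p') div t" "(a * t + p) mod t = (a' * t + p') mod t"
    by simp_all
  then show ?thesis
    using assms(1,2) by simp
qed

section \<open>Vectors supported on one coordinate block\<close>

definition block_vec :: "nat \<Rightarrow> nat \<Rightarrow> nat \<Rightarrow> (nat \<Rightarrow> complex) \<Rightarrow> complex vec" where
  "block_vec m t k w = vec (m * t) (\<lambda>l. if l div m = k then w (l mod m) else 0)"

lemma block_vec_carrier [simp]: "block_vec m t k w \<in> carrier_vec (m * t)"
  by (simp add: block_vec_def)

lemma block_index_less:
  fixes k t a m :: nat
  assumes "k < t" "a < m"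
  shows "k * m + a < m * t"
proof -
  have "k * m + a < Suc k * m" using assms by simp
  also have "\<dots> \<le> t * m" using assms by (intro mult_le_mono) auto
  finally show ?thesis by (simp add: mult.commute)
qed

lemma block_vec_index:
  assumes "k < t" "a < m"
  shows "block_vec m t k w $ (k * m + a) = w a"
  using assms block_index_less[OF assms] by (simp add: block_vec_def)

lemma block_vec_cscalar_prod:
  assumes "k < t"
  shows "block_vec m t k w \<bullet>c block_vec m t k' w' =
     (if k = k' then \<Sum>j<m. w j * cnj (w' j) else 0)"
proof (cases "k = k'")
  case True
  have "block_vec m t k w \<bullet>c block_vec m t k' w' =
      (\<Sum>l<m * t. if l div m = k then w (l mod m) * cnj (w' (l mod m)) else 0)"
    using True by (subst sum_cscalar_prod[of _ "m * t"]) (auto simp: block_vec_def intro!: sum.cong)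
  also have "\<dots> = (\<Sum>l\<in>{l. l < m * t \<and> l div m = k}. w (l mod m) * cnj (w' (l mod m)))"
    by (subst sum.inter_filter[symmetric]) (auto intro!: sum.cong)
  also have "\<dots> = (\<Sum>j<m. w j * cnj (w' j))"
    using block_index_less[OF assms, of _ m] 
    by (intro sum.reindex_bij_witness[of _ "\<lambda>j. k * m + j" "\<lambda>l. l mod m"])
      (auto intro!: mod_less_divisor gr0I)
  finally show ?thesis using True by simp
next
  case False
  then show ?thesis
    by (subst sum_cscalar_prod[of _ "m * t"]) (auto simp: block_vec_def intro!: sum.neutral)
qed

section \<open>Distributing the rotations over the bases\<close>

lemma exists_bounded_summands:
  fixes m s :: nat
  assumes "finite S" "s \<le> m * card S" "3 \<le> m \<and> s \<noteq> 1 \<or> m = 2 \<and> even s"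
  shows "\<exists>d. (\<forall>x. d x \<le> m \<and> d x \<noteq> 1) \<and> (\<forall>x. x \<notin> S \<longrightarrow> d x = 0) \<and> sum d S = s"
  using assms
proof (induction S arbitrary: s rule: finite_induct)
  case empty
  then show ?case by (intro exI[of _ "\<lambda>_. 0"]) auto
next
  case (insert y S)
  text \<open>The value \<open>r\<close> at \<open>y\<close> is chosen greedily, except that a remainder \<open>1\<close> is avoided.\<close>
  define r where "r = (if s \<le> m then s else if s = m + 1 then m - 1 else m)"
  have le: "s \<le> m + m * card S"
    using insert by simp
  have "card S \<ge> 1" if "s > m"
    using le that by (cases "card S") auto
  \<comment> \<open>For \<open>s = m + 1\<close> the choice of \<open>r\<close> leaves
    \<open>2\<close>, which must still fit into \<open>S\<close>.\<close>
  then have "2 \<le> m * card S" if "s > m"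
    using that insert.prems(2) mult_le_mono[of 2 m 1 "card S"] by auto
  then have "s - r \<le> m * card S"
    using le insert.prems(2) by (auto simp: r_def)
  moreover have "3 \<le> m \<and> s - r \<noteq> 1 \<or> m = 2 \<and> even (s - r)"
    using insert.prems(2) by (auto simp: r_def)
  ultimately obtain d where d: "\<forall>x. d x \<le> m \<and> d x \<noteq> 1" "\<forall>x. x \<notin> S \<longrightarrow> d x = 0" "sum d S = s - r"
    using insert.IH by blast
  have "sum (d(y := r)) S = sum d S"
    using insert.hyps by (intro sum.cong) auto
  moreover have "r \<le> m" "r \<noteq> 1" "r \<le> s"
    using insert.prems(2) by (auto simp: r_def)
  ultimately show ?case
    using insert.hyps d by (intro exI[of _ "d(y := r)"]) auto
qed

section \<open>The array of rotated blocks\<close>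

locale rotated_blocks =
  fixes t m :: nat and d :: "nat \<Rightarrow> nat \<Rightarrow> nat"
  assumes t_pos: "0 < t" and m_pos: "0 < m"
    and d_zero: "d k 0 = 0"
    and d_le: "d k p \<le> m"
    and d_ne: "d k p \<noteq> 1"
begin

text \<open>\<open>d k p\<close> is the number of vectors of subspace \<open>k\<close> that block
  row \<open>p\<close> rotates. The same \<open>p\<close> serves as the twist, so different block
  rows rotate into different directions.\<close>

definition entry :: "nat \<Rightarrow> nat \<Rightarrow> nat \<Rightarrow> complex vec" where
  "entry k p a = block_vec m t k (twisted_fourier t (d k p) p a)"

definition array :: "complex vec mat" where
  "array = mat (m * t) (m * t) (\<lambda>(r, s).
     entry ((r div m + s div m) mod t) (r div m) ((r mod m + s mod m) mod m))"

text \<open>Different subspaces are orthogonal whatever their bases; within one subspace the bases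
  must agree. This holds along a row, where \<open>p\<close> is fixed, and along a column, where
  \<open>k\<close> determines \<open>p\<close>.\<close>

lemma entry_orthonormal:
  assumes "k < t" "k' < t" "a < m" "a' < m" "k = k' \<Longrightarrow> p = p'"
  shows "entry k p a \<bullet>c entry k' p' a' = (if k = k' \<and> a = a' then 1 else 0)"
  using assms t_pos d_le
  by (auto simp: entry_def block_vec_cscalar_prod twisted_fourier_orthonormal)

lemma quantum_latin_square_array: "quantum_latin_square (m * t) array"
proof -
  have divt: "r div m < t" if "r < m * t" for r
    using that by (simp add: less_mult_imp_div_less mult.commute)
  have split: "r = s \<longleftrightarrow> r div m = s div m \<and> r mod m = s mod m" for r s
    by (metis div_mult_mod_eq)
  have inj: "(c + x) mod n = (c + y) mod n \<longleftrightarrow> x = y" if "x < n" "y < n" for c x y n :: nat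
    using add_mod_left_inject[OF that] by auto
  have rows: "orthonormal_basis (m * t) (\<lambda>s. array $$ (r, s))" if r: "r < m * t" for r
  proof (rule orthonormal_basisI)
    fix s s' assume s: "s < m * t" "s' < m * t"
    then show "array $$ (r, s) \<bullet>c array $$ (r, s') = (if s = s' then 1 else 0)"
      using r t_pos m_pos split[of s s']
      by (simp add: array_def entry_orthonormal inj divt)
  qed (use r in \<open>auto simp: array_def entry_def\<close>)
  have cols: "orthonormal_basis (m * t) (\<lambda>r. array $$ (r, s))" if s: "s < m * t" for s
  proof (rule orthonormal_basisI)
    fix r r' assume r: "r < m * t" "r' < m * t"
    have inj': "(x + c) mod n = (y + c) mod n \<longleftrightarrow> x = y" if "x < n" "y < n" for c x y n :: nat
      using inj[OF that, of c] by (simp add: add.commute)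
    have "array $$ (r, s) \<bullet>c array $$ (r', s) = (if (r div m + s div m) mod t = (r' div m + s div m) mod t \<and>
        (r mod m + s mod m) mod m = (r' mod m + s mod m) mod m then 1 else 0)"
      unfolding array_def using r s t_pos m_pos
      by (simp only: index_mat prod.case, intro entry_orthonormal) (auto simp: inj' divt)
    then show "array $$ (r, s) \<bullet>c array $$ (r', s) = (if r = r' then 1 else 0)"
      using r m_pos split[of r r'] by (simp add: inj' divt)
  qed (use s in \<open>auto simp: array_def entry_def\<close>)
  show ?thesis
    unfolding quantum_latin_square_def using rows cols by (auto simp: array_def)
qed

section \<open>Counting the entries up to a global phase\<close>

lemma elements_array:
  "elements_mat array = {entry k p a | k p a. k < t \<and> p < t \<and> a < m}"
proof (intro equalityI subsetI)
  fix x assume "x \<in> elements_mat array"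
  then obtain r s where "r < m * t" "s < m * t" "x = array $$ (r, s)"
    by (auto simp: array_def dest!: elements_matD)
  moreover from this have "r div m < t"
    by (simp add: less_mult_imp_div_less mult.commute)
  ultimately show "x \<in> {entry k p a | k p a. k < t \<and> p < t \<and> a < m}"
    using t_pos m_pos by (fastforce simp: array_def)
next
  fix x assume "x \<in> {entry k p a | k p a. k < t \<and> p < t \<and> a < m}"
  then obtain k p a where x: "x = entry k p a" "k < t" "p < t" "a < m" by blast
  \<comment> \<open>\<open>q\<close> is the block column in which block row \<open>p\<close> meets
    subspace \<open>k\<close>. Taking the first row of that block row makes the cyclic index equal
    to the column offset \<open>a\<close>.\<close>
  define q where "q = (k + (t - p)) mod t"
  have q: "q < t" using t_pos by (simp add: q_def)
  have "(p + q) mod t = k"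
    using x by (simp add: q_def mod_add_right_eq)
  moreover have "p * m + 0 < m * t" "q * m + a < m * t"
    using x q m_pos by (auto intro!: block_index_less simp del: add_0_right)
  ultimately have "x = array $$ (p * m + 0, q * m + a)"
    using x m_pos by (simp add: array_def)
  then show "x \<in> elements_mat array"
    using \<open>p * m + 0 < m * t\<close> \<open>q * m + a < m * t\<close>
    by (intro elements_matI[of _ "m * t" "m * t" "p * m + 0" "q * m + a"]) (auto simp: array_def)
qed

text \<open>Entries with \<open>d k p \<le> a\<close> repeat the standard basis vectors, which are already present
  in slot \<open>p = 0\<close>.\<close>

definition reps :: "(nat \<times> nat \<times> nat) set" where
  "reps = (SIGMA k:{..<t}. SIGMA p:{..<t}. {..<if p = 0 then m else d k p})"

lemma card_reps: "card reps = m * t + (\<Sum>(k, p)\<in>{..<t} \<times> {1..<t}. d k p)"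
proof -
  have "(\<Sum>p<t. if p = 0 then m else d k p) = m + (\<Sum>p\<in>{1..<t}. d k p)" for k
    using t_pos by (simp add: lessThan_atLeast0 sum.atLeast_Suc_lessThan)
  then show ?thesis
    by (simp add: reps_def sum.distrib sum.cartesian_product mult.commute)
qed

text \<open>A rotated vector has at least two nonzero entries, so it is no multiple of a standard
  basis vector; rotated vectors are told apart by \<open>twisted_fourier_inject\<close>.\<close>

lemma reps_inject:
  assumes i: "(k, p, a) \<in> reps" "(k', p', a') \<in> reps"
    and "same_global_phase (entry k p a) (entry k' p' a')"
  shows "(k, p, a) = (k', p', a')"
proof -
  from assms(3) obtain z where z: "cmod z = 1" "entry k p a = z \<cdot>\<^sub>v entry k' p' a'"
    by (auto simp: same_global_phase_iff_cmod)
  have lt: "k < t" "p < t" "a < m" "k' < t" "p' < t" "a' < m"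
    using i d_le[of k p] d_le[of k' p'] by (auto simp: reps_def split: if_splits)
  \<comment> \<open>This scalar product is \<open>z\<close>, hence nonzero, whereas different
    subspaces are orthogonal.\<close>
  have "entry k p a \<bullet>c entry k' p' a' = z * (entry k' p' a' \<bullet>c entry k' p' a')"
    unfolding z(2) by (simp add: entry_def)
  also have "\<dots> = z"
    using lt by (simp add: entry_orthonormal)
  finally have kk: "k = k'"
    using z(1) entry_orthonormal[of k k' a a' p p'] lt by (cases "k = k'") auto
  have eq: "twisted_fourier t (d k p) p a j = z * twisted_fourier t (d k' p') p' a' j" if "j < m" for j
  proof -
    have "entry k p a $ (k * m + j) = z * entry k' p' a' $ (k * m + j)"
      unfolding z(2) using block_index_less[OF lt(1) that] by (simp add: entry_def block_vec_def)
    then show ?thesis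
      using that lt kk by (simp add: entry_def block_vec_index)
  qed
  have std: False
    if "p = 0" "p' \<noteq> 0" "p' < t" "a' < d k p'" "cmod z = 1"
      "\<And>j. j < m \<Longrightarrow> twisted_fourier t (d k p) p a j = z * twisted_fourier t (d k p') p' a' j"
    for p p' a a' z
  proof -
    \<comment> \<open>One of the first two coordinates differs from \<open>a\<close>: there the
      standard vector vanishes and the rotated one does not.\<close>
    define j :: nat where "j = (if a = 0 then 1 else 0)"
    have "j < d k p'" "j \<noteq> a"
      using that d_ne[of k p'] by (auto simp: j_def)
    moreover have "z \<noteq> 0" using that by auto
    ultimately show False
      using that(6)[of j] twisted_fourier_nonzero[OF that(4), of j t p'] d_le[of k p'] that(1)
      by (simp add: d_zero twisted_fourier_def[of t 0])
  qed
  have d2: "2 \<le> d k p" if "0 < d k p" for k p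
    using that d_ne[of k p] by linarith
  consider "p = 0" "p' = 0" | "p = 0" "p' \<noteq> 0" | "p \<noteq> 0" "p' = 0" | "p \<noteq> 0" "p' \<noteq> 0" by blast
  then show ?thesis
  proof cases
    case 1
    then show ?thesis
      using eq[OF lt(3)] kk by (auto simp: d_zero twisted_fourier_def split: if_splits)
  next
    case 2
    then show ?thesis
      using std[of p p' a' z a] i(2) eq z(1) kk lt by (auto simp: reps_def)
  next
    case 3
    have "twisted_fourier t (d k p') p' a' j = inverse z * twisted_fourier t (d k p) p a j" if "j < m" for j
      using eq[OF that] z(1) kk by (auto simp: field_simps)
    then show ?thesis
      using std[of p' p a "inverse z" a'] 3 i(1) z(1) kk lt by (auto simp: reps_def norm_inverse)
  next
    case 4
    have "a < d k p" "a' < d k' p'"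
      using 4 i by (auto simp: reps_def)
    then have "p = p' \<and> a = a'"
      using d2[of k p] d2[of k' p'] d_le eq z(1) lt
      by (intro twisted_fourier_inject[of p t p' a "d k p" a' "d k' p'" m z]) auto
    then show ?thesis using kk by simp
  qed
qed

lemma qls_cardinality_array:
  "qls_cardinality array = m * t + (\<Sum>(k, p)\<in>{..<t} \<times> {1..<t}. d k p)"
  unfolding qls_cardinality_def card_reps[symmetric]
proof (rule card_quotient_eq[where f = "\<lambda>(k, p, a). entry k p a", OF equiv_same_global_phase])
  have "k < t \<and> p < t \<and> a < m" if "(k, p, a) \<in> reps" for k p a
    using that d_le[of k p] by (auto simp: reps_def split: if_splits)
  then show "(\<lambda>(k, p, a). entry k p a) ` reps \<subseteq> elements_mat array"
    unfolding elements_array by (intro image_subsetI) (clarify, blast)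
  have "\<exists>i\<in>reps. x = (\<lambda>(k, p, a). entry k p a) i" if "x \<in> elements_mat array" for x
  proof -
    from that obtain k p a where x: "x = entry k p a" "k < t" "p < t" "a < m"
      by (auto simp: elements_array)
    show ?thesis
    proof (cases "p = 0 \<or> a < d k p")
      case True
      then show ?thesis using x by (intro bexI[of _ "(k, p, a)"]) (auto simp: reps_def)
    next
      case False
      then have "x = entry k 0 a"
        using x by (auto simp: entry_def twisted_fourier_def[abs_def] d_zero)
      then show ?thesis using x t_pos by (intro bexI[of _ "(k, 0, a)"]) (auto simp: reps_def)
    qed
  qed
  moreover have "same_global_phase x x" for x
    by (auto simp: same_global_phase_iff_cmod intro!: exI[of _ 1])
  ultimately show "\<exists>i\<in>reps. ((\<lambda>(k, p, a). entry k p a) i, x)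
      \<in> {(u, w). u \<in> elements_mat array \<and> w \<in> elements_mat array \<and> same_global_phase u w}"
    if "x \<in> elements_mat array" for x
    using that by (metis (mono_tags, lifting) case_prodI mem_Collect_eq)
qed (auto dest: reps_inject)

end

lemma exists_qls_of_cardinality:
  fixes t m c :: nat
  assumes "2 \<le> t" "m * t \<le> c" "c \<le> m * t\<^sup>2" "3 \<le> m \<and> c \<noteq> m * t + 1 \<or> m = 2 \<and> even c"
  shows "\<exists>\<Phi>. quantum_latin_square (m * t) \<Phi> \<and> qls_cardinality \<Phi> = c"
proof -
  let ?S = "{..<t} \<times> {1..<t}"
  \<comment> \<open>The upper bound for \<open>c\<close> corresponds to rotating all
    \<open>m\<close> vectors in each of the \<open>t (t - 1)\<close> nonstandard bases.\<close>
  have "m * t + m * card ?S = m * t\<^sup>2"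
    using assms(1) by (cases t) (auto simp: power2_eq_square algebra_simps)
  then have "c - m * t \<le> m * card ?S"
    using assms(3) by linarith
  moreover have "3 \<le> m \<and> c - m * t \<noteq> 1 \<or> m = 2 \<and> even (c - m * t)"
    using assms(2,4) by auto
  ultimately obtain d where d: "\<forall>x. d x \<le> m \<and> d x \<noteq> 1" "\<forall>x. x \<notin> ?S \<longrightarrow> d x = 0"
    "sum d ?S = c - m * t"
    using exists_bounded_summands[of ?S] by blast
  \<comment> \<open>The pairs \<open>(k, 0)\<close> lie outside \<open>?S\<close>, where
    \<open>d\<close> vanishes; this gives \<open>d_zero\<close>.\<close>
  interpret rotated_blocks t m "\<lambda>k p. d (k, p)"
    using d assms by unfold_locales auto
  have "qls_cardinality array = c"
    using qls_cardinality_array d(3) assms(2) by simp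
  then show ?thesis
    using quantum_latin_square_array by blast
qed

theorem theorem4p7:
  fixes t :: nat
  assumes "t \<ge> 2"
  shows "(\<forall>m c :: nat. m \<ge> 3 \<and> m * t \<le> c \<and> c \<le> m * t\<^sup>2 \<and> c \<noteq> m * t + 1 \<longrightarrow>
            (\<exists>\<Phi>. quantum_latin_square (m * t) \<Phi> \<and> qls_cardinality \<Phi> = c)) \<and>
         (\<forall>c :: nat. even c \<and> 2 * t \<le> c \<and> c \<le> 2 * t\<^sup>2 \<longrightarrow>
            (\<exists>\<Phi>. quantum_latin_square (2 * t) \<Phi> \<and> qls_cardinality \<Phi> = c))"
  using exists_qls_of_cardinality[OF assms] by blast

end
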